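(* Let $n\geq 3$ and $k\geq 1$ be integers, and let $P_1,\dots,P_k$ and $P$ be regular $n$-gons in the Euclidean plane $\mathbb{R}^2$ with areas $a_1,\dots,a_k$ and $a$ respectively, satisfying $\sum_{i=1}^k a_i=a$. Then $$\mathrm{perim}(P)\leq\sum_{i=1}^k\mathrm{perim}(P_i),$$ and equality occurs only when $k=1$.
   Context: A regular $n$-gon has all sides equal and all interior angles equal; $\mathrm{perim}$ denotes the perimeter. All polygons are non-degenerate (non-zero area). *)

theory Defs
  imports "HOL-Complex_Analysis.Complex_Analysis"
begin

text \<open>
  The Euclidean plane is the type \<^typ>\<open>complex\<close>. A polygon is given by the list of its vertices in
  cyclic order, in either orientation and starting anywhere; indices are read modulo the length.
\<close>

fun polyline :: "complex list \<Rightarrow> real \<Rightarrow> complex" where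
  "polyline [] = linepath 0 0"
| "polyline [a] = linepath a a"
| "polyline [a, b] = linepath a b"
| "polyline (a # b # c # vs) = linepath a b +++ polyline (b # c # vs)"

definition boundary_path :: "complex list \<Rightarrow> real \<Rightarrow> complex" where
  "boundary_path vs = polyline (vs @ [hd vs])"

text \<open>
  \<^const>\<open>simple_path\<close> makes the boundary a Jordan curve. This excludes self-crossing (star) polygons and
  all degenerate ones: repeated vertices, overlapping sides, all vertices on one line.
\<close>

definition is_polygon :: "nat \<Rightarrow> complex list \<Rightarrow> bool" where
  "is_polygon n vs \<longleftrightarrow> n \<ge> 3 \<and> length vs = n \<and> simple_path (boundary_path vs)"

definition next_vertex :: "complex list \<Rightarrow> nat \<Rightarrow> complex" where
  "next_vertex vs i = vs ! ((i + 1) mod length vs)"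

definition prev_vertex :: "complex list \<Rightarrow> nat \<Rightarrow> complex" where
  "prev_vertex vs i = vs ! ((i + length vs - 1) mod length vs)"

definition side_length :: "complex list \<Rightarrow> nat \<Rightarrow> real" where
  "side_length vs i = dist (vs ! i) (next_vertex vs i)"

definition perim :: "complex list \<Rightarrow> real" where
  "perim vs = (\<Sum>i<length vs. side_length vs i)"

definition polygon_area :: "complex list \<Rightarrow> real" where
  "polygon_area vs = measure lebesgue (inside (path_image (boundary_path vs)))"

definition counterclockwise :: "complex list \<Rightarrow> bool" where
  "counterclockwise vs \<longleftrightarrow>
     (\<forall>z \<in> inside (path_image (boundary_path vs)). winding_number (boundary_path vs) z = 1)"

definition ccw_angle :: "complex \<Rightarrow> complex \<Rightarrow> complex \<Rightarrow> real" where
  "ccw_angle p v q = Arg2pi ((q - v) / (p - v))"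

text \<open>
  The angle at a vertex measured through the interior, in \<open>[0, 2 * pi)\<close>, hence larger than
  \<^term>\<open>pi\<close> at a reflex vertex. On a counterclockwise traversal the interior lies to the left, so it is
  swept when the ray towards the next vertex turns counterclockwise onto the ray towards the
  previous vertex. On a clockwise traversal the two rays exchange roles.
\<close>

definition interior_angle :: "complex list \<Rightarrow> nat \<Rightarrow> real" where
  "interior_angle vs i =
     (if counterclockwise vs
      then ccw_angle (next_vertex vs i) (vs ! i) (prev_vertex vs i)
      else ccw_angle (prev_vertex vs i) (vs ! i) (next_vertex vs i))"

definition regular_ngon :: "nat \<Rightarrow> complex list \<Rightarrow> bool" where
  "regular_ngon n vs \<longleftrightarrow>
     is_polygon n vs \<and>
     (\<forall>i<n. \<forall>j<n. side_length vs i = side_length vs j) \<and>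
     (\<forall>i<n. \<forall>j<n. interior_angle vs i = interior_angle vs j)"

end

(* All regular n-gons are similar: equal sides and equal angles make each edge vector a fixed
   multiple w of the previous one, so the vertices are c + A * w^k with w^n = 1, and a boundary that
   does not cross itself forces w = exp(2 pi i / n) or its inverse, since otherwise two non-adjacent
   sides of the star polygon meet. Hence area = K * perim^2 with K > 0 depending only on n, and the
   claim becomes sum p_i^2 <= (sum p_i)^2 for positive p_i, strict when there are at least two
   of them. *)
theory Submission
  imports Defs
begin

section \<open>Area in the complex plane under affine maps\<close>

text \<open>The behaviour of Lebesgue measure under linear maps is available only on \<^typ>\<open>real ^ 'n\<close>.\<close>

lemma lborel_complex_eq:
  "(lborel :: complex measure) = distr lborel borel (\<lambda>x::real^2. Complex (x $ 1) (x $ 2))"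
proof (rule lborel_eqI)
  have cont: "continuous_on UNIV (\<lambda>x::real^2. Complex (x $ 1) (x $ 2))"
    unfolding Complex_eq by (intro continuous_intros)
  then have meas: "(\<lambda>x::real^2. Complex (x $ 1) (x $ 2)) \<in> borel_measurable borel"
    by (rule borel_measurable_continuous_onI)
  fix l u :: complex
  assume le: "\<And>b. b \<in> Basis \<Longrightarrow> l \<bullet> b \<le> u \<bullet> b"
  define l' u' :: "real^2" where "l' = vector [Re l, Im l]" and "u' = vector [Re u, Im u]"
  have comp: "l' $ 1 = Re l" "l' $ 2 = Im l" "u' $ 1 = Re u" "u' $ 2 = Im u"
    by (simp_all add: l'_def u'_def)
  have "Re l \<le> Re u" "Im l \<le> Im u"
    using le[of 1] le[of \<i>] by (auto simp: Basis_complex_def inner_complex_def)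
  then have le': "\<forall>i. l' $ i \<le> u' $ i"
    by (simp add: forall_2 comp)
  have vim: "(\<lambda>x::real^2. Complex (x $ 1) (x $ 2)) -` box l u = box l' u'"
    by (auto simp: mem_box_cart forall_2 comp mem_box Basis_complex_def inner_complex_def)
  have "emeasure (distr lborel borel (\<lambda>x::real^2. Complex (x $ 1) (x $ 2))) (box l u)
      = emeasure lborel (box l' u')"
    using meas by (simp add: emeasure_distr vim)
  \<comment> \<open>An open box and its closure have the same measure; the closed one has a volume
    formula in coordinates.\<close>
  also have "\<dots> = ennreal (measure lborel (cbox l' u'))"
    by (metis emeasure_lborel_box_eq emeasure_lborel_cbox_eq emeasure_eq_ennreal_measure
        emeasure_lborel_cbox_finite less_irrefl infinity_ennreal_def)
  also have "measure lborel (cbox l' u') = (Re u - Re l) * (Im u - Im l)"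
    using le' by (simp add: content_cbox_cart interval_ne_empty_cart UNIV_2 comp)
  also have "\<dots> = (\<Prod>b\<in>Basis. (u - l) \<bullet> b)"
    by (simp add: Basis_complex_def inner_complex_def complex_eq_iff)
  finally show "emeasure (distr lborel borel (\<lambda>x::real^2. Complex (x $ 1) (x $ 2))) (box l u)
      = (\<Prod>b\<in>Basis. (u - l) \<bullet> b)" .
qed simp

text \<open>Transfers areas to \<open>real^2\<close>: on Borel sets \<open>lebesgue\<close> agrees
  with \<open>lborel\<close>, which \<open>lborel_complex_eq\<close> presents as a
  push-forward.\<close>

lemma measure_complex_borel:
  fixes S :: "complex set"
  assumes "S \<in> sets borel"
  shows "measure lebesgue S = measure lebesgue ((\<lambda>x::real^2. Complex (x $ 1) (x $ 2)) -` S)"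
    and "(\<lambda>x::real^2. Complex (x $ 1) (x $ 2)) -` S \<in> sets borel"
proof -
  have "continuous_on UNIV (\<lambda>x::real^2. Complex (x $ 1) (x $ 2))"
    unfolding Complex_eq by (intro continuous_intros)
  then have meas: "(\<lambda>x::real^2. Complex (x $ 1) (x $ 2)) \<in> borel_measurable borel"
    by (rule borel_measurable_continuous_onI)
  then show vim: "(\<lambda>x::real^2. Complex (x $ 1) (x $ 2)) -` S \<in> sets borel"
    using measurable_sets[OF meas assms] by simp
  have "measure lebesgue S = measure lborel S"
    using assms by (simp add: measure_completion)
  also have "\<dots> = measure lborel ((\<lambda>x::real^2. Complex (x $ 1) (x $ 2)) -` S)"
    by (subst lborel_complex_eq) (use meas assms in \<open>simp add: measure_distr\<close>)
  finally show "measure lebesgue S = measure lebesgue ((\<lambda>x::real^2. Complex (x $ 1) (x $ 2)) -` S)"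
    using vim by (simp add: measure_completion)
qed

text \<open>In coordinates, multiplication by \<open>A\<close> is the linear map \<open>L\<close>,
  whose determinant is the squared modulus of \<open>A\<close>, and translations preserve measure.
  Openness makes the sets Borel; boundedness makes the preimage of \<open>S\<close> of finite
  measure, as \<open>measure_linear_image\<close> requires.\<close>

lemma measure_complex_affine:
  fixes S :: "complex set"
  assumes "open S" "bounded S" "A \<noteq> 0"
  shows "measure lebesgue ((\<lambda>z. c + A * z) ` S) = (cmod A)\<^sup>2 * measure lebesgue S"
proof -
  let ?h = "\<lambda>x::real^2. Complex (x $ 1) (x $ 2)"
  define L :: "real^2 \<Rightarrow> real^2" where
    "L x = vector [Re A * x $ 1 - Im A * x $ 2, Im A * x $ 1 + Re A * x $ 2]" for x
  have hL: "?h (L x) = A * ?h x" for x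
    by (simp add: L_def complex_eq_iff algebra_simps)
  have lin: "linear L"
    by (rule linearI) (simp_all add: L_def vec_eq_iff forall_2 algebra_simps)
  have det: "\<bar>det (matrix L)\<bar> = (cmod A)\<^sup>2"
    by (simp add: det_2 matrix_def L_def axis_def cmod_def power2_eq_square)
  have surj: "\<exists>x. z = ?h x" for z
    by (rule exI[of _ "vector [Re z, Im z]"]) (simp add: complex_eq_iff)
  have inj: "?h x = ?h y \<longleftrightarrow> x = y" for x y
    by (auto simp: complex_eq_iff vec_eq_iff forall_2)
  have bd: "bounded (?h -` S)"
  proof -
    obtain B where B: "\<And>z. z \<in> S \<Longrightarrow> cmod z \<le> B"
      using assms(2) by (auto simp: bounded_iff)
    have "norm x \<le> B + B" if "?h x \<in> S" for x
    proof -
      have "norm x \<le> \<bar>x $ 1\<bar> + \<bar>x $ 2\<bar>"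
        using norm_le_l1_cart[of x] by (simp add: UNIV_2)
      also have "\<dots> \<le> cmod (?h x) + cmod (?h x)"
        using abs_Re_le_cmod[of "?h x"] abs_Im_le_cmod[of "?h x"] by simp
      finally show ?thesis using B[OF that] by linarith
    qed
    then show ?thesis by (auto simp: bounded_iff)
  qed
  have lmeas: "?h -` S \<in> lmeasurable"
    using bd measure_complex_borel(2)[of S] assms(1)
    by (intro bounded_set_imp_lmeasurable) auto
  have vim: "?h -` ((*) A ` S) = L ` (?h -` S)"
  proof (rule set_eqI)
    fix y
    show "y \<in> ?h -` ((*) A ` S) \<longleftrightarrow> y \<in> L ` (?h -` S)"
    proof
      assume "y \<in> ?h -` ((*) A ` S)"
      then obtain z where z: "z \<in> S" "?h y = A * z" by auto
      obtain x where x: "z = ?h x" using surj by blast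
      have "?h y = ?h (L x)" using z x hL by simp
      then have "y = L x" by (simp only: inj)
      then show "y \<in> L ` (?h -` S)" using z x by auto
    qed (auto simp: hL)
  qed
  have "open ((*) A ` S)"
  proof -
    have "(*) A ` S = (\<lambda>z. z / A) -` S"
      using assms(3) by (auto simp: image_iff intro!: bexI[of _ "_ / A"])
    then show ?thesis
      using assms by (auto intro!: open_vimage continuous_intros)
  qed
  have "(\<lambda>z. c + A * z) ` S = (+) c ` (*) A ` S" by (simp add: image_image)
  then have "measure lebesgue ((\<lambda>z. c + A * z) ` S) = measure lebesgue ((*) A ` S)"
    by (simp add: measure_translation)
  also have "\<dots> = measure lebesgue (?h -` ((*) A ` S))"
    using \<open>open ((*) A ` S)\<close> by (intro measure_complex_borel) auto
  also have "\<dots> = (cmod A)\<^sup>2 * measure lebesgue (?h -` S)"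
    by (simp only: vim measure_linear_image[OF lin lmeas] det)
  also have "\<dots> = (cmod A)\<^sup>2 * measure lebesgue S"
    using assms(1) measure_complex_borel(1)[of S] by auto
  finally show ?thesis .
qed

section \<open>The inside of a set under affine maps\<close>

text \<open>The inverse \<open>g\<close> carries the complementary component of \<open>f x\<close>
  into that of \<open>x\<close>, which is bounded when \<open>x\<close> is inside; applying
  \<open>f\<close> to the result keeps it bounded and gives back the component of
  \<open>f x\<close>.\<close>

lemma inside_homeomorphism_subset:
  fixes f g :: "'a::euclidean_space \<Rightarrow> 'a"
  assumes "continuous_on UNIV g" and gf: "\<And>x. g (f x) = x" and fg: "\<And>x. f (g x) = x"
    and bd: "\<And>B. bounded B \<Longrightarrow> bounded (f ` B)"
  shows "f ` inside S \<subseteq> inside (f ` S)"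
proof
  fix y assume "y \<in> f ` inside S"
  then obtain x where x: "y = f x" "x \<notin> S" "bounded (connected_component_set (- S) x)"
    by (auto simp: inside_def)
  let ?C = "connected_component_set (- f ` S) y"
  have y: "y \<notin> f ` S" using x by (metis gf imageE)
  have "g ` ?C \<subseteq> connected_component_set (- S) x"
  proof (rule connected_component_maximal)
    show "x \<in> g ` ?C" using x y gf by (metis Compl_iff connected_component_refl_eq image_eqI mem_Collect_eq)
    show "connected (g ` ?C)"
      using assms(1) by (meson connected_connected_component connected_continuous_image continuous_on_subset subset_UNIV)
    show "g ` ?C \<subseteq> - S"
      using fg connected_component_subset[of "- f ` S" y] by (force simp: image_iff)
  qed
  then have "bounded (f ` g ` ?C)" using x bd bounded_subset by blast
  then show "y \<in> inside (f ` S)" using y fg by (simp add: inside_def image_image)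
qed

text \<open>The inverse of the map is again affine, so the inclusion above applies in both
  directions.\<close>

lemma inside_complex_affine:
  fixes S :: "complex set"
  assumes "A \<noteq> 0"
  shows "inside ((\<lambda>z. c + A * z) ` S) = (\<lambda>z. c + A * z) ` inside S"
proof
  have bd: "bounded ((\<lambda>z. d + B * z) ` X)" if "bounded X" for d B :: complex and X
  proof -
    have "(\<lambda>z. d + B * z) ` X = (+) d ` (*) B ` X" by (simp add: image_image)
    then show ?thesis
      using that bounded_linear_image[OF _ bounded_linear_mult_right] bounded_translation by metis
  qed
  let ?f = "\<lambda>z. c + A * z" and ?g = "\<lambda>z. (- c / A) + (1 / A) * z"
  have cont: "continuous_on UNIV ?f" "continuous_on UNIV ?g" by (intro continuous_intros)+
  have gf: "?g (?f z) = z" and fg: "?f (?g z) = z" for z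
    using assms by (simp_all add: field_simps)
  show "?f ` inside S \<subseteq> inside (?f ` S)"
    by (rule inside_homeomorphism_subset[OF cont(2) gf fg bd])
  have "?g ` inside (?f ` S) \<subseteq> inside (?g ` ?f ` S)"
    by (rule inside_homeomorphism_subset[OF cont(1) fg gf bd])
  also have "?g ` ?f ` S = S" using gf by (simp only: image_image image_ident)
  finally have "?f ` ?g ` inside (?f ` S) \<subseteq> ?f ` inside S" by blast
  then show "inside (?f ` S) \<subseteq> ?f ` inside S" using fg by (simp only: image_image image_ident)
qed

section \<open>Boundary paths as unions of sides\<close>

lemma pathstart_polyline [simp]: "vs \<noteq> [] \<Longrightarrow> pathstart (polyline vs) = hd vs"
  by (induction vs rule: polyline.induct) auto

lemma pathfinish_polyline [simp]: "vs \<noteq> [] \<Longrightarrow> pathfinish (polyline vs) = last vs"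
  by (induction vs rule: polyline.induct) auto

text \<open>The length bound excludes the constant paths of the first two equations of
  \<open>polyline\<close>: their image is a point, while the union is empty.\<close>

lemma path_image_polyline:
  "2 \<le> length vs \<Longrightarrow>
    path_image (polyline vs) = (\<Union>i<length vs - 1. closed_segment (vs ! i) (vs ! Suc i))"
proof (induction vs rule: polyline.induct)
  case (4 a b c vs)
  have "path_image (polyline (a # b # c # vs))
      = closed_segment a b \<union> path_image (polyline (b # c # vs))"
    by (simp add: path_image_join)
  then show ?case
    using 4 by (simp add: lessThan_Suc_eq_insert_0 image_image)
qed (auto simp: lessThan_Suc)

text \<open>Extending the vertices periodically lets edge recurrences run over all natural numbers,
  with closing up expressed as periodicity.\<close>

definition cyclic_vertex :: "complex list \<Rightarrow> nat \<Rightarrow> complex" where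
  "cyclic_vertex vs k = vs ! (k mod length vs)"

lemma nth_closed_vertices:
  assumes "vs \<noteq> []" "i \<le> length vs"
  shows "(vs @ [hd vs]) ! i = cyclic_vertex vs i"
  using assms by (cases "i = length vs") (auto simp: cyclic_vertex_def nth_append hd_conv_nth)

lemma path_image_boundary_path:
  assumes "vs \<noteq> []"
  shows "path_image (boundary_path vs)
    = (\<Union>i<length vs. closed_segment (cyclic_vertex vs i) (cyclic_vertex vs (Suc i)))"
proof -
  have "2 \<le> length (vs @ [hd vs])" using assms by (cases vs) auto
  then have "path_image (boundary_path vs) = (\<Union>i<length vs.
      closed_segment ((vs @ [hd vs]) ! i) ((vs @ [hd vs]) ! Suc i))"
    unfolding boundary_path_def by (subst path_image_polyline) auto
  also have "\<dots> = (\<Union>i<length vs.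
      closed_segment (cyclic_vertex vs i) (cyclic_vertex vs (Suc i)))"
    using assms by (intro SUP_cong) (auto simp: nth_closed_vertices)
  finally show ?thesis .
qed

lemma boundary_path_loop:
  "vs \<noteq> [] \<Longrightarrow> pathfinish (boundary_path vs) = pathstart (boundary_path vs)"
  by (simp add: boundary_path_def)

text \<open>The boundary is the first side joined to the rest, and a simple join consists of arcs
  that meet at most at the two junctions. The first side is enough later on: a repeated or crossing
  side of a star polygon can always be found against it.\<close>

lemma is_polygon_first_side:
  assumes "is_polygon n vs"
  shows "cyclic_vertex vs 0 \<noteq> cyclic_vertex vs 1"
    and "\<lbrakk>0 < j; j < n\<rbrakk> \<Longrightarrow>
      closed_segment (cyclic_vertex vs 0) (cyclic_vertex vs 1) \<inter>
      closed_segment (cyclic_vertex vs j) (cyclic_vertex vs (Suc j))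
      \<subseteq> {cyclic_vertex vs 0, cyclic_vertex vs 1}"
proof -
  from assms have n: "n \<ge> 3" "length vs = n" "simple_path (boundary_path vs)"
    by (auto simp: is_polygon_def)
  then obtain a b c us where vs: "vs = a # b # c # us"
    by (cases vs; cases "tl vs"; cases "tl (tl vs)") auto
  define rest where "rest = b # c # us @ [a]"
  have "boundary_path vs = linepath a b +++ polyline rest"
    by (simp add: boundary_path_def vs rest_def)
  with n have "simple_path (linepath a b +++ polyline rest)" by simp
  moreover have "pathfinish (linepath a b) = pathstart (polyline rest)"
    by (simp add: rest_def)
  ultimately have arc: "arc (linepath a b)"
    and sub: "path_image (linepath a b) \<inter> path_image (polyline rest) \<subseteq> {a, b}"
    by (auto elim!: simple_path_joinE simp: rest_def)
  have ab: "cyclic_vertex vs 0 = a" "cyclic_vertex vs 1 = b"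
    by (simp_all add: cyclic_vertex_def vs)
  show "cyclic_vertex vs 0 \<noteq> cyclic_vertex vs 1"
    using arc_distinct_ends[OF arc] ab by simp
  assume j: "0 < j" "j < n"
  \<comment> \<open>Dropping the first vertex shifts indices: side \<open>j\<close> of the polygon
    is side \<open>j - 1\<close> of \<open>rest\<close>.\<close>
  have "rest ! i = cyclic_vertex vs (Suc i)" if "i < n" for i
    using that nth_closed_vertices[of vs "Suc i"] n by (simp add: vs rest_def)
  then have "closed_segment (cyclic_vertex vs j) (cyclic_vertex vs (Suc j))
      = closed_segment (rest ! (j - 1)) (rest ! Suc (j - 1))"
    using j by simp
  also have "\<dots> \<subseteq> path_image (polyline rest)"
    using j n by (subst path_image_polyline) (auto simp: rest_def vs intro!: bexI[of _ "j - 1"])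
  finally show "closed_segment (cyclic_vertex vs 0) (cyclic_vertex vs 1) \<inter>
      closed_segment (cyclic_vertex vs j) (cyclic_vertex vs (Suc j))
      \<subseteq> {cyclic_vertex vs 0, cyclic_vertex vs 1}"
    using sub ab by auto
qed

section \<open>Vertices as a geometric progression\<close>

lemma next_vertex_conv: "next_vertex vs (k mod length vs) = cyclic_vertex vs (Suc k)"
  by (simp add: next_vertex_def cyclic_vertex_def mod_simps)

lemma prev_vertex_conv:
  assumes "vs \<noteq> []"
  shows "prev_vertex vs (Suc k mod length vs) = cyclic_vertex vs k"
proof -
  have "(Suc k mod length vs + length vs - 1) mod length vs
      = (Suc k mod length vs + (length vs - 1)) mod length vs"
    using assms by (cases vs) auto
  also have "\<dots> = (Suc k + (length vs - 1)) mod length vs"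
    by (rule mod_add_left_eq)
  also have "Suc k + (length vs - 1) = k + length vs"
    using assms by (cases vs) auto
  finally show ?thesis by (simp add: prev_vertex_def cyclic_vertex_def)
qed

lemma perim_conv:
  "perim vs = (\<Sum>i<length vs. dist (cyclic_vertex vs i) (cyclic_vertex vs (Suc i)))"
  unfolding perim_def side_length_def
  by (intro sum.cong) (auto simp: cyclic_vertex_def next_vertex_def)

text \<open>Equal sides give the quotient of the two rays at each vertex modulus 1, and equal angles
  fix its argument. Hence this quotient is the same at all vertices, and \<open>\<omega>\<close> is
  minus its inverse.\<close>

lemma regular_ngon_rotation:
  assumes "regular_ngon n vs"
  obtains \<omega> where "\<And>k. cyclic_vertex vs (Suc (Suc k)) - cyclic_vertex vs (Suc k)
      = \<omega> * (cyclic_vertex vs (Suc k) - cyclic_vertex vs k)"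
proof -
  let ?v = "cyclic_vertex vs"
  from assms have poly: "is_polygon n vs"
    and side: "\<And>i j. \<lbrakk>i < n; j < n\<rbrakk> \<Longrightarrow> side_length vs i = side_length vs j"
    and angle: "\<And>i j. \<lbrakk>i < n; j < n\<rbrakk> \<Longrightarrow> interior_angle vs i = interior_angle vs j"
    unfolding regular_ngon_def by blast+
  from poly have n: "n \<ge> 3" "length vs = n" and "vs \<noteq> []"
    by (auto simp: is_polygon_def)
  have len: "cmod (?v (Suc k) - ?v k) = dist (?v 0) (?v 1)" for k
  proof -
    have "dist (?v k) (?v (Suc k)) = side_length vs (k mod n)"
      using n next_vertex_conv[of vs k] by (simp add: side_length_def cyclic_vertex_def)
    also have "\<dots> = side_length vs (0 mod n)"
      using n by (intro side) auto
    also have "\<dots> = dist (?v 0) (?v 1)"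
      using n next_vertex_conv[of vs 0] by (simp add: side_length_def cyclic_vertex_def)
    finally show ?thesis by (simp add: dist_norm norm_minus_commute)
  qed
  have pos: "dist (?v 0) (?v 1) > 0"
    using is_polygon_first_side(1)[OF poly] by simp
  have nz: "?v (Suc k) - ?v k \<noteq> 0" for k
    using len[of k] pos by auto
  \<comment> \<open>At vertex \<open>Suc k\<close>, the ray to the previous vertex divided by the
    ray to the next one. Its argument is the interior angle for counterclockwise lists; for the
    others the inverse takes its place, in the same way at every vertex.\<close>
  define q where "q k = (?v k - ?v (Suc k)) / (?v (Suc (Suc k)) - ?v (Suc k))" for k
  have q1: "cmod (q k) = 1" for k
    using len[of k] len[of "Suc k"] pos by (simp add: q_def norm_divide norm_minus_commute)
  have ang: "interior_angle vs (Suc k mod n)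
      = (if counterclockwise vs then Arg2pi (q k) else Arg2pi (inverse (q k)))" for k
    using n next_vertex_conv[of vs "Suc k"] prev_vertex_conv[OF \<open>vs \<noteq> []\<close>, of k]
    by (simp add: interior_angle_def ccw_angle_def q_def cyclic_vertex_def)
  have "q k = q 0" for k
  proof -
    have eq: "interior_angle vs (Suc k mod n) = interior_angle vs (Suc 0 mod n)"
      using n by (intro angle) auto
    have unit: "x = y" if "cmod x = 1" "cmod y = 1" "Arg2pi x = Arg2pi y" for x y
      using Arg2pi_eq[of x] Arg2pi_eq[of y] that by simp
    show ?thesis
    proof (cases "counterclockwise vs")
      case True
      then have "Arg2pi (q k) = Arg2pi (q 0)" using eq unfolding ang by simp
      then show ?thesis using q1 by (intro unit)
    next
      case False
      then have "Arg2pi (inverse (q k)) = Arg2pi (inverse (q 0))" using eq unfolding ang by simp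
      then have "inverse (q k) = inverse (q 0)"
        using q1 by (intro unit) (simp_all add: norm_inverse)
      then show ?thesis by simp
    qed
  qed
  then have "?v (Suc (Suc k)) - ?v (Suc k) = (- inverse (q 0)) * (?v (Suc k) - ?v k)" for k
  proof -
    have "q k \<noteq> 0" using q1[of k] by auto
    moreover have "?v k - ?v (Suc k) = q k * (?v (Suc (Suc k)) - ?v (Suc k))"
      using nz[of "Suc k"] by (simp add: q_def)
    ultimately have "?v (Suc (Suc k)) - ?v (Suc k) = inverse (q k) * (?v k - ?v (Suc k))"
      by simp
    then show ?thesis
      unfolding \<open>q k = q 0\<close> by (metis minus_diff_eq mult_minus_left mult_minus_right)
  qed
  then show ?thesis using that by blast
qed

text \<open>The edges are \<open>\<omega> ^ k * d\<close>, and a geometric sum gives the vertices.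
  Edge \<open>n\<close> is edge 0, so \<open>\<omega>\<close> is a root of unity;
  \<open>\<omega> = 1\<close> would move the vertices along a line without ever returning.\<close>

lemma regular_ngon_vertices:
  assumes "regular_ngon n vs"
  obtains c A \<omega> where "A \<noteq> 0" "\<omega> \<noteq> 1" "\<omega> ^ n = 1" "\<And>k. cyclic_vertex vs k = c + A * \<omega> ^ k"
proof -
  let ?v = "cyclic_vertex vs"
  from assms have poly: "is_polygon n vs" and n: "n \<ge> 3" "length vs = n"
    by (auto simp: regular_ngon_def is_polygon_def)
  obtain \<omega> where step: "\<And>k. ?v (Suc (Suc k)) - ?v (Suc k) = \<omega> * (?v (Suc k) - ?v k)"
    using regular_ngon_rotation[OF assms] by blast
  define d where "d = ?v 1 - ?v 0"
  have d: "d \<noteq> 0" using is_polygon_first_side(1)[OF poly] by (simp add: d_def)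
  have diff: "?v (Suc k) - ?v k = \<omega> ^ k * d" for k
    by (induction k) (simp_all add: d_def step)
  have per: "?v n = ?v 0" "?v (Suc n) = ?v 1"
    using n by (simp_all add: cyclic_vertex_def mod_Suc)
  have pow: "\<omega> ^ n = 1"
    using diff[of n] d by (simp add: per d_def)
  have "\<omega> \<noteq> 1"
  proof
    assume "\<omega> = 1"
    then have "?v k = ?v 0 + of_nat k * d" for k
    proof (induction k)
      case (Suc k)
      then show ?case using diff[of k] by (simp add: algebra_simps)
    qed simp
    from this[of n] show False using d n per by simp
  qed
  \<comment> \<open>Chosen so that \<open>A * \<omega> ^ k\<close> has the edges as its differences;
    \<open>?v 0 - A\<close> then becomes the centre.\<close>
  define A where "A = d / (\<omega> - 1)"
  have A: "A \<noteq> 0" "A * (\<omega> - 1) = d" using d \<open>\<omega> \<noteq> 1\<close> by (simp_all add: A_def)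
  have "?v k = (?v 0 - A) + A * \<omega> ^ k" for k
  proof (induction k)
    case (Suc k)
    have "?v (Suc k) = ?v k + \<omega> ^ k * (A * (\<omega> - 1))"
      using diff[of k] A by (simp add: algebra_simps)
    then show ?case using Suc by (simp add: algebra_simps)
  qed simp
  with A \<open>\<omega> \<noteq> 1\<close> pow show ?thesis using that by blast
qed

section \<open>Exclusion of star polygons\<close>

text \<open>The bounds on \<open>m\<close> make the endpoints of the two chords of the unit circle
  interleave. The bounds on \<open>s\<close> are strict because sides of a simple polygon may meet
  at the endpoints of the first one.\<close>

lemma star_chords_cross:
  fixes m n :: nat
  assumes "1 < m" "m + 1 < n"
  shows "\<exists>s u. 0 < s \<and> s < 1 \<and> 0 \<le> u \<and> u \<le> 1 \<and>
    (1 - s) *\<^sub>R 1 + s *\<^sub>R cis (2 * pi * m / n)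
    = (1 - u) *\<^sub>R cis (2 * pi / n) + u *\<^sub>R (cis (2 * pi / n) * cis (2 * pi * m / n))"
proof -
  \<comment> \<open>Half the angle spanned by the chord and half the rotation angle. The bounds on
    \<open>m\<close> put both \<open>\<phi> - \<alpha>\<close> and \<open>\<phi> + \<alpha>\<close>
    strictly between 0 and \<open>pi\<close>.\<close>
  define \<phi> \<alpha> where "\<phi> = pi * m / n" and "\<alpha> = pi / n"
  have n: "real n > 0" using assms by simp
  have "\<phi> - \<alpha> = pi * ((m - 1) / n)" "\<phi> + \<alpha> = pi * ((m + 1) / n)"
    using assms by (simp_all add: \<phi>_def \<alpha>_def field_simps of_nat_diff)
  moreover have "0 < pi * x \<and> pi * x < pi" if "0 < x" "x < 1" for x
    using that by simp
  moreover have "0 < real (m - 1) / n" "real (m - 1) / n < 1" "0 < real (m + 1) / n" "real (m + 1) / n < 1"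
    using assms by (auto simp: field_simps)
  ultimately have "0 < \<phi> - \<alpha>" "\<phi> - \<alpha> < pi" "0 < \<phi> + \<alpha>" "\<phi> + \<alpha> < pi"
    by metis+
  then have sub: "sin (\<phi> - \<alpha>) > 0" and add: "sin (\<phi> + \<alpha>) > 0"
    by (auto intro: sin_gt_zero)
  have prod: "sin \<phi> * cos \<alpha> > \<bar>cos \<phi> * sin \<alpha>\<bar>"
    using sub add by (simp add: sin_diff sin_add abs_if)
  \<comment> \<open>The second chord is the first rotated by \<open>2 * \<alpha>\<close>. They meet on the ray that bisects the directions
    of their midpoints, at signed offsets \<open>r\<close> and \<open>-r\<close> relative to half the chord length.\<close>
  define r where "r = (cos \<phi> * sin \<alpha>) / (sin \<phi> * cos \<alpha>)"
  have r: "\<bar>r\<bar> < 1" using prod by (simp add: r_def abs_divide)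
  have nz: "sin \<phi> * cos \<alpha> \<noteq> 0" using prod by linarith
  then have rr: "r * sin \<phi> * cos \<alpha> = cos \<phi> * sin \<alpha>" by (simp add: r_def)
  have c2: "cis (2 * pi * m / n) = cis \<phi> * cis \<phi>" "cis (2 * pi / n) = cis \<alpha> * cis \<alpha>"
    by (simp_all add: cis_mult \<phi>_def \<alpha>_def mult.assoc)
  \<comment> \<open>The chord seen from its midpoint, which lies in direction
    \<open>cis \<phi>\<close>: \<open>t = -1\<close> gives the endpoint 1, and \<open>t = 1\<close>
    the other one.\<close>
  have chord: "(1 - (1 + t) / 2) *\<^sub>R 1 + ((1 + t) / 2) *\<^sub>R (cis \<phi> * cis \<phi>)
      = cis \<phi> * Complex (cos \<phi>) (t * sin \<phi>)" for t
  proof -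
    have id: "cos \<phi> * cos \<phi> = 1 - sin \<phi> * sin \<phi>"
      using sin_cos_squared_add[of \<phi>] by (simp add: power2_eq_square)
    show ?thesis by (simp add: complex_eq_iff field_simps id)
  qed
  have cross: "cis \<alpha> * cis \<alpha> * Complex (cos \<phi>) (- r * sin \<phi>) = Complex (cos \<phi>) (r * sin \<phi>)"
  proof -
    \<comment> \<open>By \<open>rr\<close> the right-hand side is real, so it equals its conjugate,
      which is the left-hand side.\<close>
    have "cis \<alpha> * Complex (cos \<phi>) (- r * sin \<phi>) = cis (- \<alpha>) * Complex (cos \<phi>) (r * sin \<phi>)"
      using rr by (simp add: complex_eq_iff algebra_simps)
    then have "cis \<alpha> * cis \<alpha> * Complex (cos \<phi>) (- r * sin \<phi>)
        = (cis \<alpha> * cis (- \<alpha>)) * Complex (cos \<phi>) (r * sin \<phi>)"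
      by (simp add: mult.assoc)
    then show ?thesis by (simp add: cis_mult)
  qed
  have "(1 - (1 - r) / 2) *\<^sub>R cis (2 * pi / n) + ((1 - r) / 2) *\<^sub>R (cis (2 * pi / n) * cis (2 * pi * m / n))
      = cis \<alpha> * cis \<alpha> * (cis \<phi> * Complex (cos \<phi>) (- r * sin \<phi>))"
    unfolding c2 using chord[of "- r", symmetric]
    by (simp add: scaleR_conv_of_real distrib_left mult_ac)
  also have "\<dots> = cis \<phi> * Complex (cos \<phi>) (r * sin \<phi>)"
    using cross by (simp add: algebra_simps)
  also have "\<dots> = (1 - (1 + r) / 2) *\<^sub>R 1 + ((1 + r) / 2) *\<^sub>R cis (2 * pi * m / n)"
    using chord[of r] c2 by simp
  finally show ?thesis
    using r by (intro exI[of _ "(1 + r) / 2"] exI[of _ "(1 - r) / 2"]) (auto simp: abs_less_iff)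
qed

text \<open>Write \<open>\<omega>\<close> as the power \<open>m\<close> of the basic root. If
  \<open>m\<close> shares a factor with \<open>n\<close>, the first side is traversed again; if
  \<open>m\<close> is coprime to \<open>n\<close> but neither 1 nor \<open>n - 1\<close>, the
  polygon is a star and its first side is crossed.\<close>

lemma regular_ngon_primitive_root:
  assumes "regular_ngon n vs"
  obtains c A \<omega> where "A \<noteq> 0" "\<omega> = cis (2 * pi / n) \<or> \<omega> = inverse (cis (2 * pi / n))"
    "\<And>k. cyclic_vertex vs k = c + A * \<omega> ^ k"
proof -
  let ?v = "cyclic_vertex vs" and ?\<zeta> = "cis (2 * pi / n)"
  from assms have poly: "is_polygon n vs" and n: "n \<ge> 3" "length vs = n"
    by (auto simp: regular_ngon_def is_polygon_def)
  obtain c A \<omega> where A: "A \<noteq> 0" and \<omega>: "\<omega> \<noteq> 1" "\<omega> ^ n = 1" and v: "\<And>k. ?v k = c + A * \<omega> ^ k"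
    using regular_ngon_vertices[OF assms] by metis
  have \<zeta>n: "?\<zeta> ^ n = 1" using n by (simp add: Complex.DeMoivre)
  have \<zeta>_mod: "?\<zeta> ^ a = ?\<zeta> ^ (a mod n)" for a
  proof -
    have "?\<zeta> ^ a = ?\<zeta> ^ (n * (a div n) + a mod n)" by simp
    also have "\<dots> = ?\<zeta> ^ (a mod n)" by (simp only: power_add power_mult \<zeta>n) simp
    finally show ?thesis .
  qed
  have "\<omega> \<in> (\<lambda>k. cis (2 * pi * real k / real n)) ` {..<n}"
    using Complex.bij_betw_roots_unity[of n] n \<omega> unfolding bij_betw_def by simp
  then obtain m where m: "m < n" "\<omega> = cis (2 * pi * m / n)" by auto
  then have \<omega>m: "\<omega> = ?\<zeta> ^ m" by (simp add: Complex.DeMoivre mult_ac)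
  have m0: "0 < m" using m \<omega> by (cases m) auto
  have no_cross: "p = ?v 0 \<or> p = ?v 1"
    if "0 < j" "j < n" "p \<in> closed_segment (?v 0) (?v 1)" "p \<in> closed_segment (?v j) (?v (Suc j))" for p j
    using is_polygon_first_side(2)[OF poly that(1,2)] that(3,4) by auto
  have interior: "c + A * ((1 - s) *\<^sub>R 1 + s *\<^sub>R \<omega>) \<in> closed_segment (?v 0) (?v 1) - {?v 0, ?v 1}"
    if "0 < s" "s < 1" for s
  proof -
    let ?p = "c + A * ((1 - s) *\<^sub>R 1 + s *\<^sub>R \<omega>)"
    have eq: "?p = (1 - s) *\<^sub>R ?v 0 + s *\<^sub>R ?v 1"
      by (simp add: v scaleR_conv_of_real algebra_simps)
    have "?p - ?v 0 = A * of_real s * (\<omega> - 1)" "?p - ?v 1 = A * of_real (1 - s) * (1 - \<omega>)"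
      by (simp_all add: v scaleR_conv_of_real algebra_simps)
    then have "?p - ?v 0 \<noteq> 0" "?p - ?v 1 \<noteq> 0"
      using A \<omega> that by (auto simp del: of_real_diff)
    moreover have "?p \<in> closed_segment (?v 0) (?v 1)"
      unfolding in_segment using that eq by (intro exI[of _ s]) simp
    ultimately show ?thesis by simp
  qed
  have "coprime m n"
  proof (rule ccontr)
    assume "\<not> coprime m n"
    define g where "g = gcd m n"
    have "g \<noteq> 1" using \<open>\<not> coprime m n\<close> by (simp add: g_def coprime_iff_gcd_eq_1)
    moreover have "g \<noteq> 0" using n by (simp add: g_def)
    ultimately have g1: "g > 1" by simp
    obtain j m' where j: "n = g * j" "m = g * m'" by (metis g_def gcd_dvd1 gcd_dvd2 dvdE)
    \<comment> \<open>With \<open>j = n div g\<close> the power \<open>\<omega> ^ j\<close> is 1, so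
      side \<open>j\<close> repeats side 0, and the midpoint of side 0 gives the
      contradiction.\<close>
    have jn: "0 < j" "j < n" using j g1 n by (auto intro!: Nat.gr0I)
    have "\<omega> ^ j = ?\<zeta> ^ (n * m')" by (simp add: \<omega>m j mult_ac flip: power_mult)
    then have "\<omega> ^ j = 1" by (simp add: power_mult \<zeta>n)
    then have "?v j = ?v 0" "?v (Suc j) = ?v 1" by (simp_all add: v)
    then show False
      using no_cross[OF jn] interior[of "1/2"] by auto
  qed
  \<comment> \<open>An inverse of \<open>m\<close> modulo \<open>n\<close> locates the side that
    starts at the basic root, that is, the first side rotated by \<open>2 * pi / n\<close>. This is
    the second chord of \<open>star_chords_cross\<close>.\<close>
  then obtain j' y where "m * j' = n * y + 1"
    using bezout_nat[of m n] m0 by auto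
  then have j': "m * (j' mod n) mod n = 1"
    using n mod_mult_self4[of n y 1] by (simp add: mod_simps)
  define j where "j = j' mod n"
  have j: "0 < j" "j < n" "m * j mod n = 1"
    using j' n by (auto simp: j_def intro!: Nat.gr0I)
  have \<omega>j: "\<omega> ^ j = ?\<zeta>"
    using j \<zeta>_mod[of "m * j"] by (simp add: \<omega>m power_mult)
  have "m = 1 \<or> m + 1 = n"
  proof (rule ccontr)
    assume "\<not> ?thesis"
    then have "1 < m" "m + 1 < n" using m m0 by auto
    from star_chords_cross[OF this] obtain s u where su: "0 < s" "s < 1" "0 \<le> u" "u \<le> 1"
      "(1 - s) *\<^sub>R 1 + s *\<^sub>R \<omega> = (1 - u) *\<^sub>R ?\<zeta> + u *\<^sub>R (?\<zeta> * \<omega>)"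
      unfolding m(2) by blast
    have "c + A * ((1 - s) *\<^sub>R 1 + s *\<^sub>R \<omega>) = (1 - u) *\<^sub>R ?v j + u *\<^sub>R ?v (Suc j)"
      unfolding su(5) by (simp add: v \<omega>j scaleR_conv_of_real algebra_simps)
    then have "c + A * ((1 - s) *\<^sub>R 1 + s *\<^sub>R \<omega>) \<in> closed_segment (?v j) (?v (Suc j))"
      using su by (auto simp: in_segment)
    then show False using no_cross[OF j(1,2)] interior[OF su(1,2)] by blast
  qed
  \<comment> \<open>The two values of \<open>m\<close> are the two orientations of the same convex
    polygon.\<close>
  then have "\<omega> = ?\<zeta> \<or> \<omega> = inverse ?\<zeta>"
  proof
    assume "m + 1 = n"
    then have "\<omega> * ?\<zeta> = 1" using \<zeta>n by (simp add: \<omega>m flip: power_Suc2)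
    then show ?thesis by (simp add: field_simps)
  qed (simp add: \<omega>m)
  then show ?thesis using that A v by blast
qed

section \<open>Similarity to a model polygon and the area formula\<close>

text \<open>The boundary of the regular polygon inscribed in the unit circle, kept as a set so that
  vertex lists of either orientation yield affine images of it.\<close>

definition unit_ngon_boundary :: "nat \<Rightarrow> complex set" where
  "unit_ngon_boundary n =
    (\<Union>i<n. closed_segment (cis (2 * pi / n) ^ i) (cis (2 * pi / n) ^ Suc i))"

lemma closed_segment_affine:
  fixes c A x y :: complex
  shows "closed_segment (c + A * x) (c + A * y) = (\<lambda>z. c + A * z) ` closed_segment x y"
proof -
  have "(+) c ` (*) A ` closed_segment x y = closed_segment (c + A * x) (c + A * y)"
    by (simp add: closed_segment_linear_image closed_segment_translation
        bounded_linear.linear[OF bounded_linear_mult_right])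
  then show ?thesis by (simp add: image_image)
qed

lemma regular_ngon_similar:
  assumes "regular_ngon n vs"
  obtains c A where "A \<noteq> 0" "path_image (boundary_path vs) = (\<lambda>z. c + A * z) ` unit_ngon_boundary n"
    "perim vs = n * cmod A * cmod (cis (2 * pi / n) - 1)"
proof -
  let ?v = "cyclic_vertex vs" and ?\<zeta> = "cis (2 * pi / n)"
  from assms have n: "n \<ge> 3" "length vs = n" "vs \<noteq> []"
    by (auto simp: regular_ngon_def is_polygon_def)
  obtain c A \<omega> where A: "A \<noteq> 0" and \<omega>: "\<omega> = ?\<zeta> \<or> \<omega> = inverse ?\<zeta>"
    and v: "\<And>k. ?v k = c + A * \<omega> ^ k"
    using regular_ngon_primitive_root[OF assms] by metis
  have \<zeta>n: "?\<zeta> ^ n = 1" using n by (simp add: Complex.DeMoivre)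
  have "(\<Union>i<n. closed_segment (\<omega> ^ i) (\<omega> ^ Suc i)) = unit_ngon_boundary n"
    using \<omega>
  proof
    assume "\<omega> = inverse ?\<zeta>"
    then have inv: "\<omega> ^ i = ?\<zeta> ^ (n - i)" if "i \<le> n" for i
    proof -
      have "?\<zeta> ^ (n - i) * ?\<zeta> ^ i = 1" using that \<zeta>n by (simp flip: power_add)
      then show ?thesis
        unfolding \<open>\<omega> = inverse ?\<zeta>\<close> power_inverse by (metis inverse_unique mult.commute)
    qed
    \<comment> \<open>For the inverse root the sides are run through backwards: side
      \<open>i\<close> is the model side \<open>n - Suc i\<close> with its endpoints
      exchanged.\<close>
    have "(\<Union>i<n. closed_segment (\<omega> ^ i) (\<omega> ^ Suc i))
        = (\<Union>i<n. closed_segment (?\<zeta> ^ (n - Suc i)) (?\<zeta> ^ Suc (n - Suc i)))"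
    proof (intro SUP_cong refl)
      fix i assume "i \<in> {..<n}"
      then have "Suc (n - Suc i) = n - i" "i \<le> n" "Suc i \<le> n" by auto
      then show "closed_segment (\<omega> ^ i) (\<omega> ^ Suc i)
          = closed_segment (?\<zeta> ^ (n - Suc i)) (?\<zeta> ^ Suc (n - Suc i))"
        by (simp only: inv closed_segment_commute)
    qed
    also have "\<dots> = (\<Union>i\<in>(\<lambda>i. n - Suc i) ` {..<n}. closed_segment (?\<zeta> ^ i) (?\<zeta> ^ Suc i))"
      by (simp only: image_image)
    also have "(\<lambda>i. n - Suc i) ` {..<n} = {..<n}"
    proof -
      have "i \<in> (\<lambda>i. n - Suc i) ` {..<n}" if "i < n" for i
        using that by (intro image_eqI[of _ _ "n - Suc i"]) auto
      then show ?thesis by auto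
    qed
    finally show ?thesis by (simp add: unit_ngon_boundary_def)
  qed (simp add: unit_ngon_boundary_def)
  then have "path_image (boundary_path vs) = (\<lambda>z. c + A * z) ` unit_ngon_boundary n"
    by (simp only: path_image_boundary_path[OF n(3)] n(2) v closed_segment_affine flip: image_UN)
  moreover have "perim vs = n * cmod A * cmod (?\<zeta> - 1)"
  proof -
    have unit: "cmod \<omega> = 1" using \<omega> by (auto simp: norm_inverse)
    have "cmod (1 - \<omega>) = cmod (?\<zeta> - 1)"
      using \<omega>
    proof
      assume "\<omega> = inverse ?\<zeta>"
      then have "?\<zeta> * \<omega> = 1" by (simp add: cis_mult)
      then have "1 - \<omega> = (?\<zeta> - 1) * \<omega>" by (simp only: left_diff_distrib mult_1)
      then show ?thesis using unit by (simp add: norm_mult)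
    qed (simp add: norm_minus_commute)
    moreover have "dist (?v i) (?v (Suc i)) = cmod A * cmod (1 - \<omega>)" for i
    proof -
      have "?v i - ?v (Suc i) = A * \<omega> ^ i * (1 - \<omega>)" by (simp add: v algebra_simps)
      then show ?thesis by (simp add: dist_norm norm_mult norm_power unit)
    qed
    ultimately show ?thesis using n by (simp add: perim_conv)
  qed
  ultimately show ?thesis using that A by blast
qed

text \<open>By the Jordan curve theorem the inside is non-empty, open and bounded, hence of finite
  positive measure.\<close>

lemma polygon_area_pos:
  assumes "is_polygon n vs"
  shows "polygon_area vs > 0"
proof -
  let ?I = "inside (path_image (boundary_path vs))"
  have "simple_path (boundary_path vs)" "vs \<noteq> []"
    using assms by (auto simp: is_polygon_def)
  then have I: "?I \<noteq> {}" "open ?I" "bounded ?I"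
    using Jordan_inside_outside boundary_path_loop by blast+
  then have "?I \<in> lmeasurable" by (intro lmeasurable_open)
  moreover have "\<not> negligible ?I" using I open_not_negligible by blast
  ultimately show ?thesis
    by (simp add: polygon_area_def negligible_iff_measure0 order_less_le)
qed

text \<open>Area and squared perimeter both scale by the squared modulus of \<open>A\<close>, so
  their ratio is that of the model polygon.\<close>

lemma regular_ngon_area:
  assumes "regular_ngon n vs"
  shows "polygon_area vs =
    measure lebesgue (inside (unit_ngon_boundary n)) / (n * cmod (cis (2 * pi / n) - 1))\<^sup>2 * (perim vs)\<^sup>2"
    and "perim vs > 0"
proof -
  let ?s = "cmod (cis (2 * pi / n) - 1)" and ?I = "inside (unit_ngon_boundary n)"
  have poly: "is_polygon n vs" and n: "n \<ge> 3"
    using assms by (auto simp: regular_ngon_def is_polygon_def)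
  obtain c A where A: "A \<noteq> 0"
    and im: "path_image (boundary_path vs) = (\<lambda>z. c + A * z) ` unit_ngon_boundary n"
    and per: "perim vs = n * cmod A * ?s"
    using regular_ngon_similar[OF assms] by blast
  have "perim vs \<noteq> 0"
  proof
    assume "perim vs = 0"
    then have "dist (cyclic_vertex vs 0) (cyclic_vertex vs (Suc 0)) = 0"
      using poly n unfolding perim_conv
      by (subst (asm) sum_nonneg_eq_0_iff) (auto simp: is_polygon_def)
    then show False using is_polygon_first_side(1)[OF poly] by simp
  qed
  \<comment> \<open>The perimeter is a multiple of \<open>?s\<close>, so the non-zero first side
    also shows that the model has sides of positive length.\<close>
  then have s: "?s > 0" using per by auto
  then show "perim vs > 0" using per A n by simp
  have compact: "compact (unit_ngon_boundary n)"
    by (auto simp: unit_ngon_boundary_def intro!: compact_UN)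
  have I: "open ?I" "bounded ?I"
    using compact by (simp_all add: open_inside bounded_inside compact_imp_closed compact_imp_bounded)
  have "polygon_area vs = (cmod A)\<^sup>2 * measure lebesgue ?I"
    by (simp only: polygon_area_def im inside_complex_affine[OF A] measure_complex_affine[OF I A])
  also have "(cmod A)\<^sup>2 = (perim vs)\<^sup>2 / (n * ?s)\<^sup>2"
    using s n by (simp add: per power_mult_distrib)
  finally show "polygon_area vs = measure lebesgue ?I / (n * ?s)\<^sup>2 * (perim vs)\<^sup>2"
    by simp
qed

section \<open>Sums of squares and the perimeter inequality\<close>

lemma sum_power2_le:
  fixes f :: "'a \<Rightarrow> real"
  assumes "finite I" "\<And>i. i \<in> I \<Longrightarrow> f i \<ge> 0"
  shows "(\<Sum>i\<in>I. (f i)\<^sup>2) \<le> (\<Sum>i\<in>I. f i)\<^sup>2"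
  using assms
proof (induction I rule: finite_induct)
  case (insert i I)
  have "0 \<le> f i * sum f I" using insert by (intro mult_nonneg_nonneg sum_nonneg) auto
  with insert show ?case by (simp add: power2_sum)
qed simp

text \<open>With one index split off, the cross term with the sum of the others is strictly
  positive, since at least one other index remains.\<close>

lemma sum_power2_less:
  fixes f :: "'a \<Rightarrow> real"
  assumes "finite I" "\<And>i. i \<in> I \<Longrightarrow> f i > 0" "card I > 1"
  shows "(\<Sum>i\<in>I. (f i)\<^sup>2) < (\<Sum>i\<in>I. f i)\<^sup>2"
proof -
  obtain i where i: "i \<in> I" using assms(3) by fastforce
  let ?J = "I - {i}"
  have "?J \<noteq> {}" using assms(1,3) i by (metis card.empty card_Diff_singleton less_irrefl zero_less_diff)
  then have "sum f ?J > 0" using assms by (intro sum_pos) auto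
  then have "0 < f i * sum f ?J" using assms(2)[OF i] by simp
  moreover have "(\<Sum>j\<in>?J. (f j)\<^sup>2) \<le> (sum f ?J)\<^sup>2"
    using assms by (intro sum_power2_le) (auto intro: less_imp_le)
  ultimately have "(f i)\<^sup>2 + (\<Sum>j\<in>?J. (f j)\<^sup>2) < (f i + sum f ?J)\<^sup>2"
    by (simp add: power2_sum)
  then show ?thesis using i assms(1) by (simp add: sum.remove)
qed

theorem corollary2p2:
  fixes n k :: nat
    and Ps :: "nat \<Rightarrow> complex list" and P :: "complex list"
    and as :: "nat \<Rightarrow> real" and a :: real
  assumes "n \<ge> 3" and "k \<ge> 1"
    and "\<And>i. i \<in> {1..k} \<Longrightarrow> regular_ngon n (Ps i)"
    and "regular_ngon n P"
    and "\<And>i. i \<in> {1..k} \<Longrightarrow> as i = polygon_area (Ps i)"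
    and "a = polygon_area P"
    and "(\<Sum>i=1..k. as i) = a"
  shows "perim P \<le> (\<Sum>i=1..k. perim (Ps i)) \<and>
         (perim P = (\<Sum>i=1..k. perim (Ps i)) \<longrightarrow> k = 1)"
proof -
  define K where "K = measure lebesgue (inside (unit_ngon_boundary n)) / (n * cmod (cis (2 * pi / n) - 1))\<^sup>2"
  have area: "polygon_area vs = K * (perim vs)\<^sup>2" if "regular_ngon n vs" for vs
    unfolding K_def using that by (rule regular_ngon_area(1))
  \<comment> \<open>Needed to cancel \<open>K\<close> from the area equation; it follows from the
    positive area of \<open>P\<close>.\<close>
  have "K \<noteq> 0"
    using polygon_area_pos[of n P] area[OF assms(4)] assms(4) by (auto simp: regular_ngon_def)
  have "(\<Sum>i=1..k. K * (perim (Ps i))\<^sup>2) = K * (perim P)\<^sup>2"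
    using assms(3-7) area by (metis (mono_tags, lifting) sum.cong)
  then have sq: "(\<Sum>i=1..k. (perim (Ps i))\<^sup>2) = (perim P)\<^sup>2"
    using \<open>K \<noteq> 0\<close> by (simp flip: sum_distrib_left)
  have pos: "perim (Ps i) > 0" if "i \<in> {1..k}" for i
    using assms(3)[OF that] by (rule regular_ngon_area(2))
  have "(perim P)\<^sup>2 \<le> (\<Sum>i=1..k. perim (Ps i))\<^sup>2"
    unfolding sq[symmetric] using pos by (intro sum_power2_le less_imp_le) simp_all
  then have "perim P \<le> (\<Sum>i=1..k. perim (Ps i))"
    using pos by (elim power2_le_imp_le) (intro sum_nonneg less_imp_le, simp)
  moreover have "k = 1" if "perim P = (\<Sum>i=1..k. perim (Ps i))"
  proof (rule ccontr)
    assume "k \<noteq> 1"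
    then have "(perim P)\<^sup>2 < (\<Sum>i=1..k. perim (Ps i))\<^sup>2"
      unfolding sq[symmetric] using assms(2) pos by (intro sum_power2_less) auto
    with that show False by simp
  qed
  ultimately show ?thesis by blast
qed

end
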